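(* Let $Q \in \mathcal{Q}_3$ be a connected quiver. The following algorithm terminates after finitely many steps and correctly decides whether $Q$ is mutation-cyclic or mutation-acyclic. (1) If the current quiver is acyclic, stop: $Q$ is mutation-acyclic. (2) Otherwise the current quiver is a cyclic quiver with ordered parameters $0 < a \le b \le c$. If $ab \le c$, stop: $Q$ is mutation-acyclic. (3) Otherwise, perform a mutation at the point opposite to $c$ (the point not incident to the $c$ parallel arrows). If the total number of arrows has decreased, replace the current quiver by the mutated quiver and go back to step (1). If not, stop: the current quiver (before this last mutation) is a root, and $Q$ is mutation-cyclic.
   Context: $\mathcal{Q}_3$ is the set of quivers with three points, finitely many arrows, and neither loops nor oriented cycles of length two. Mutation of a quiver $Q$ at a point $k$ is defined by: (1) all arrows of $Q$ starting or ending at $k$ are reversed; (2) if $Q$ has $r_{ij}$ paths of length two from $i$ to $j$ passing through $k$, then $r_{ij}$ arrows from $i$ to $j$ are added; (3) all pairs of arrows forming cycles of length two are deleted (pairwise cancellation until no such pair remains). Quivers are considered up to isomorphism and up to replacing a quiver by its opposite; the mutation class of $Q$ is the set of all quivers obtained from it by finite sequences of mutations (up to isomorphism and passing to the opposite quiver). A quiver is cyclic if it contains an oriented cycle, and acyclic otherwise. It is mutation-acyclic if its mutation class contains an acyclic quiver, and mutation-cyclic otherwise. A cyclic quiver in $\mathcal{Q}_3$ is, up to isomorphism and passing to the opposite, given by parameters $0<a\le b\le c$: it has $a$ arrows from $2$ to $1$, $b$ arrows from $1$ to $3$, and $c$ arrows from $3$ to $2$. A root is a cyclic quiver in $\mathcal{Q}_3$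 whose parameters $a\le b\le c$ satisfy $2\le a\le b\le c$ and $ab\ge 2c$. *)

theory Defs
  imports Main "HOL-Library.Numeral_Type"
begin

text \<open>
  A quiver on the vertex set \<open>'v\<close> is given by its arrow multiplicities: \<open>Q i j\<close> is the
  number of arrows from \<open>i\<close> to \<open>j\<close>. This determines a quiver with finitely many arrows
  between any two points up to an isomorphism fixing the points.
\<close>

type_synonym 'v quiver = "'v \<Rightarrow> 'v \<Rightarrow> nat"

definition Q3 :: "3 quiver set" where
  "Q3 = {Q. (\<forall>i. Q i i = 0) \<and> (\<forall>i j. Q i j = 0 \<or> Q j i = 0)}"

definition arrow_rel :: "'v quiver \<Rightarrow> 'v rel" where
  "arrow_rel Q = {(i, j). Q i j > 0}"

definition connected_quiver :: "'v quiver \<Rightarrow> bool" where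
  "connected_quiver Q \<longleftrightarrow> (\<forall>i j. (i, j) \<in> (arrow_rel Q \<union> (arrow_rel Q)\<inverse>)\<^sup>*)"

definition acyclic_quiver :: "'v quiver \<Rightarrow> bool" where
  "acyclic_quiver Q \<longleftrightarrow> acyclic (arrow_rel Q)"

definition cyclic_quiver :: "'v quiver \<Rightarrow> bool" where
  "cyclic_quiver Q \<longleftrightarrow> \<not> acyclic_quiver Q"

definition num_arrows :: "'v::finite quiver \<Rightarrow> nat" where
  "num_arrows Q = (\<Sum>i\<in>UNIV. \<Sum>j\<in>UNIV. Q i j)"

definition opposite_quiver :: "'v quiver \<Rightarrow> 'v quiver" where
  "opposite_quiver Q = (\<lambda>i j. Q j i)"

definition isomorphic_quivers :: "'v quiver \<Rightarrow> 'w quiver \<Rightarrow> bool" where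
  "isomorphic_quivers Q R \<longleftrightarrow> (\<exists>f. bij f \<and> (\<forall>i j. R (f i) (f j) = Q i j))"

definition iso_or_opposite :: "'v quiver \<Rightarrow> 'w quiver \<Rightarrow> bool" where
  "iso_or_opposite Q R \<longleftrightarrow>
     isomorphic_quivers Q R \<or> isomorphic_quivers (opposite_quiver Q) R"

definition reverse_at :: "'v \<Rightarrow> 'v quiver \<Rightarrow> 'v quiver" where
  "reverse_at k Q = (\<lambda>i j. if i = k \<or> j = k then Q j i else Q i j)"

definition paths_through :: "'v \<Rightarrow> 'v quiver \<Rightarrow> 'v \<Rightarrow> 'v \<Rightarrow> nat" where
  "paths_through k Q i j = Q i k * Q k j"

text \<open>Truncated subtraction: all pairs of opposite arrows between \<open>i\<close> and \<open>j\<close> are removed.\<close>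

definition cancel_two_cycles :: "'v quiver \<Rightarrow> 'v quiver" where
  "cancel_two_cycles Q = (\<lambda>i j. Q i j - Q j i)"

definition mutate :: "'v \<Rightarrow> 'v quiver \<Rightarrow> 'v quiver" where
  "mutate k Q =
     cancel_two_cycles (\<lambda>i j. reverse_at k Q i j + paths_through k Q i j)"

definition mutation_class :: "'v quiver \<Rightarrow> 'v quiver set" where
  "mutation_class Q = {R. \<exists>ks. iso_or_opposite (fold mutate ks Q) R}"

definition mutation_acyclic :: "'v quiver \<Rightarrow> bool" where
  "mutation_acyclic Q \<longleftrightarrow> (\<exists>R\<in>mutation_class Q. acyclic_quiver R)"

definition mutation_cyclic :: "'v quiver \<Rightarrow> bool" where
  "mutation_cyclic Q \<longleftrightarrow> \<not> mutation_acyclic Q"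

text \<open>In the type \<open>3\<close> the points \<open>1\<close>, \<open>2\<close>, \<open>3\<close> are distinct (and \<open>3\<close> is the element \<open>0\<close>).\<close>

definition cyclic_triangle :: "nat \<Rightarrow> nat \<Rightarrow> nat \<Rightarrow> 3 quiver" where
  "cyclic_triangle a b c = (\<lambda>i j.
     if i = 2 \<and> j = 1 then a
     else if i = 1 \<and> j = 3 then b
     else if i = 3 \<and> j = 2 then c
     else 0)"

definition has_parameters :: "3 quiver \<Rightarrow> nat \<Rightarrow> nat \<Rightarrow> nat \<Rightarrow> bool" where
  "has_parameters Q a b c \<longleftrightarrow>
     0 < a \<and> a \<le> b \<and> b \<le> c \<and> iso_or_opposite Q (cyclic_triangle a b c)"

definition root :: "3 quiver \<Rightarrow> bool" where
  "root Q \<longleftrightarrow> Q \<in> Q3 \<and> cyclic_quiver Q \<and>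
     (\<exists>a b c. has_parameters Q a b c \<and> 2 \<le> a \<and> a * b \<ge> 2 * c)"

text \<open>
  The point \<open>k\<close> is not incident to some bundle of \<open>c\<close> parallel arrows. If the largest parameter
  \<open>c\<close> is attained by two sides, there are several such \<open>k\<close>, and the algorithm may use any of them.
\<close>

definition opposite_point :: "3 quiver \<Rightarrow> nat \<Rightarrow> 3 \<Rightarrow> bool" where
  "opposite_point Q c k \<longleftrightarrow> (\<exists>i j. i \<noteq> j \<and> i \<noteq> k \<and> j \<noteq> k \<and> Q i j = c)"

datatype verdict = Says_mutation_acyclic | Says_mutation_cyclic

text \<open>A halted state records the verdict together with the quiver that was current at the stop.\<close>

datatype state = Running "3 quiver" | Halted verdict "3 quiver"

inductive step :: "state \<Rightarrow> state \<Rightarrow> bool" where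
  stop_acyclic:
    "acyclic_quiver R \<Longrightarrow> step (Running R) (Halted Says_mutation_acyclic R)"
| stop_small_product:
    "cyclic_quiver R \<Longrightarrow> has_parameters R a b c \<Longrightarrow> a * b \<le> c \<Longrightarrow>
     step (Running R) (Halted Says_mutation_acyclic R)"
| continue:
    "cyclic_quiver R \<Longrightarrow> has_parameters R a b c \<Longrightarrow> \<not> a * b \<le> c \<Longrightarrow>
     opposite_point R c k \<Longrightarrow> num_arrows (mutate k R) < num_arrows R \<Longrightarrow>
     step (Running R) (Running (mutate k R))"
| stop_root:
    "cyclic_quiver R \<Longrightarrow> has_parameters R a b c \<Longrightarrow> \<not> a * b \<le> c \<Longrightarrow>
     opposite_point R c k \<Longrightarrow> \<not> num_arrows (mutate k R) < num_arrows R \<Longrightarrow>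
     step (Running R) (Halted Says_mutation_cyclic R)"

end

theory Submission
  imports Defs
begin

text \<open>
  The total number of arrows drops at every round, so the algorithm cannot run forever, and every
  cyclic quiver on three points is an oriented triangle, so the algorithm never gets stuck.
  Mutating an oriented triangle at the point opposite to the side \<open>c\<close> replaces \<open>c\<close> by
  \<open>a b - c\<close> (lemma \<open>mutate_triangle\<close>). If \<open>a b \<le> c\<close>, the orientation of that
  side becomes compatible with the other two and the result is acyclic. If the number of arrows
  does not drop, then \<open>a b \<ge> 2 c\<close>, which forces \<open>a \<ge> 2\<close>, and the quiver is a root.

  It remains to see that roots are mutation-cyclic. On oriented triangles whose mutations stay
  cyclic, the Markov-type expression \<open>C = x\<^sup>2 + y\<^sup>2 + z\<^sup>2 - x y z\<close> is invariant,
  since \<open>x\<close> and \<open>y z - x\<close> are the two zeros of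
  \<open>t\<^sup>2 - y z t + y\<^sup>2 + z\<^sup>2 - C\<close>. The identity
  \<open>(x - 2) (y z - x - 2) = (y - z)\<^sup>2 + 4 - C\<close> shows that the region
  \<open>x, y, z \<ge> 2\<close>, \<open>C \<le> 4\<close> is closed under mutation (lemma
  \<open>markov_region_step\<close>), and it contains all roots (lemma \<open>root_in_markov_region\<close>).
  As mutation is an involution, a quiver from which the region can be reached lies in the region
  itself, so none of its mutations is acyclic.
\<close>

section \<open>The Markov region\<close>

definition markov_region :: "int \<Rightarrow> int \<Rightarrow> int \<Rightarrow> bool" where
  "markov_region x y z \<longleftrightarrow>
     2 \<le> x \<and> 2 \<le> y \<and> 2 \<le> z \<and> x * x + y * y + z * z \<le> x * y * z + 4"

lemma markov_region_rotate: "markov_region x y z \<Longrightarrow> markov_region y z x"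
  unfolding markov_region_def by (simp add: algebra_simps)

text \<open>
  For \<open>x > 2\<close> the sign of \<open>(x - 2) (y z - x - 2)\<close> settles the claim. On the boundary
  \<open>x = 2\<close> this product vanishes, but there the inequality reads \<open>(y - z)\<^sup>2 \<le> 0\<close>, so
  the new side is \<open>y\<^sup>2 - 2\<close>.
\<close>
lemma markov_region_step:
  assumes "markov_region x y z"
  shows "markov_region (y * z - x) z y"
proof -
  have b: "2 \<le> x" "2 \<le> y" "2 \<le> z" and C: "x * x + y * y + z * z \<le> x * y * z + 4"
    using assms unfolding markov_region_def by auto
  have "2 \<le> y * z - x"
  proof (cases "x = 2")
    case True
    have "(y - z) * (y - z) \<le> 0"
      using C True by (simp add: algebra_simps)
    then have "y = z"
      by (metis eq_iff_diff_eq_0 mult_eq_0_iff order_antisym zero_le_square)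
    moreover have "2 * 2 \<le> y * y"
      using b by (intro mult_mono) auto
    ultimately show ?thesis using True by simp
  next
    case False
    have "(x - 2) * (y * z - x - 2) = (y - z) * (y - z) + 4 - (x * x + y * y + z * z - x * y * z)"
      by (simp add: algebra_simps)
    also have "\<dots> \<ge> 0"
      using C zero_le_square[of "y - z"] by linarith
    finally have "0 \<le> (x - 2) * (y * z - x - 2)" .
    moreover have "0 < x - 2" using False b by simp
    ultimately show ?thesis
      by (simp add: zero_le_mult_iff)
  qed
  moreover have "(y * z - x) * (y * z - x) + z * z + y * y - (y * z - x) * z * y
      = x * x + y * y + z * z - x * y * z"
    by (simp add: algebra_simps)
  ultimately show ?thesis
    using b C unfolding markov_region_def by linarith
qed

text \<open>
  As a function of \<open>c\<close>, the expression \<open>C\<close> is decreasing up to \<open>c = a b / 2\<close>, so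
  its value at a root is at most its value \<open>a\<^sup>2 - (a - 2) b\<^sup>2\<close> at \<open>c = b\<close>.
\<close>
lemma root_in_markov_region:
  fixes a b c :: int
  assumes "2 \<le> a" "a \<le> b" "b \<le> c" "2 * c \<le> a * b"
  shows "markov_region a b c"
proof -
  have "0 \<le> (c - b) * (a * b - b - c)"
    using assms by (intro mult_nonneg_nonneg) auto
  moreover have "(a - 2) * (a * a) \<le> (a - 2) * (b * b)"
    using assms by (intro mult_left_mono mult_mono) auto
  moreover have "a * a - (a - 2) * (a * a) \<le> 4"
  proof (cases "a = 2")
    case False
    then have "(3 - a) * (a * a) \<le> 0"
      using assms by (intro mult_nonpos_nonneg) auto
    then show ?thesis by (simp add: algebra_simps)
  qed simp
  ultimately have "a * a + b * b + c * c \<le> a * b * c + 4"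
    by (simp add: algebra_simps)
  then show ?thesis
    using assms unfolding markov_region_def by auto
qed

section \<open>Mutation of quivers with three points\<close>

lemma Q3D: "Q \<in> Q3 \<Longrightarrow> Q i i = 0" "Q \<in> Q3 \<Longrightarrow> Q i j = 0 \<or> Q j i = 0"
  unfolding Q3_def by auto

lemma Q3_reverse_zero: "Q \<in> Q3 \<Longrightarrow> 0 < Q i j \<Longrightarrow> Q j i = 0"
  using Q3D(2)[of Q i j] by auto

lemma UNIV_three:
  fixes i j k :: 3
  assumes "distinct [i, j, k]"
  shows "UNIV = {i, j, k}"
proof -
  have "card {i, j, k} = card (UNIV :: 3 set)"
    using assms by simp
  then show ?thesis
    by (metis card_subset_eq finite subset_UNIV)
qed

lemma three_cases:
  fixes i j k m :: 3
  assumes "distinct [i, j, k]"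
  shows "m = i \<or> m = j \<or> m = k"
  using UNIV_three[OF assms] by blast

lemma mutate_in_Q3: "mutate k Q \<in> Q3"
  unfolding Q3_def mutate_def cancel_two_cycles_def by auto

lemma mutate_at:
  assumes "Q \<in> Q3"
  shows "mutate k Q i k = Q k i" "mutate k Q k i = Q i k"
  using Q3D(1)[OF assms] Q3D(2)[OF assms, of i k]
  by (auto simp: mutate_def cancel_two_cycles_def reverse_at_def paths_through_def)

lemma mutate_away:
  assumes "i \<noteq> k" "j \<noteq> k"
  shows "mutate k Q i j = (Q i j + Q i k * Q k j) - (Q j i + Q j k * Q k i)"
  using assms by (simp add: mutate_def cancel_two_cycles_def reverse_at_def paths_through_def)

text \<open>
  The second mutation adds as many paths through \<open>k\<close> as the first one, but in the opposite
  direction.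
\<close>
lemma mutate_involution:
  assumes "Q \<in> Q3"
  shows "mutate k (mutate k Q) = Q"
proof (intro ext)
  fix i j
  show "mutate k (mutate k Q) i j = Q i j"
  proof (cases "i = k \<or> j = k")
    case True
    then show ?thesis
      using mutate_at[OF assms] mutate_at[OF mutate_in_Q3] by auto
  next
    case False
    then have "mutate k (mutate k Q) i j =
        (mutate k Q i j + Q j k * Q k i) - (mutate k Q j i + Q i k * Q k j)"
      by (simp add: mutate_away[of i k j "mutate k Q"] mutate_at[OF assms] mult.commute)
    also have "\<dots> = Q i j"
      using False Q3D(2)[OF assms, of i j] by (auto simp: mutate_away)
    finally show ?thesis .
  qed
qed

lemma num_arrows_three:
  fixes Q :: "3 quiver"
  assumes "Q \<in> Q3" "distinct [i, j, k]"
  shows "num_arrows Q = Q i j + Q j i + Q j k + Q k j + Q k i + Q i k"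
  using assms by (simp add: num_arrows_def UNIV_three[OF assms(2)] Q3D(1))

section \<open>Oriented triangles\<close>

definition triangle :: "3 quiver \<Rightarrow> 3 \<Rightarrow> 3 \<Rightarrow> 3 \<Rightarrow> bool" where
  "triangle Q i j k \<longleftrightarrow>
     Q \<in> Q3 \<and> distinct [i, j, k] \<and> 0 < Q i j \<and> 0 < Q j k \<and> 0 < Q k i"

lemma triangle_rotate: "triangle Q i j k \<Longrightarrow> triangle Q j k i"
  unfolding triangle_def by auto

lemma triangle_reverse_zero:
  assumes "triangle Q i j k"
  shows "Q j i = 0" "Q k j = 0" "Q i k = 0"
  using assms Q3_reverse_zero unfolding triangle_def by auto

lemma triangle_imp_cyclic:
  assumes "triangle Q i j k"
  shows "cyclic_quiver Q"
proof -
  have "(i, j) \<in> arrow_rel Q" "(j, k) \<in> arrow_rel Q" "(k, i) \<in> arrow_rel Q"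
    using assms by (auto simp: triangle_def arrow_rel_def)
  then have "(i, i) \<in> (arrow_rel Q)\<^sup>+"
    by (meson r_into_trancl trancl_into_trancl)
  then show ?thesis
    by (auto simp: cyclic_quiver_def acyclic_quiver_def acyclic_def)
qed

text \<open>
  Without loops and two-cycles, a path that is extended beyond two arrows either closes up to a
  triangle or turns back along one of its own arrows. So without triangles all paths have length
  at most two, and none of them is closed.
\<close>
lemma cyclic_imp_triangle:
  assumes Q: "Q \<in> Q3" and "cyclic_quiver Q"
  obtains i j k where "triangle Q i j k"
proof -
  let ?r = "arrow_rel Q"
  have no_loop: "(x, x) \<notin> ?r" for x
    using Q3D(1)[OF Q] by (simp add: arrow_rel_def)
  have no_back: "(x, y) \<in> ?r \<Longrightarrow> (y, x) \<notin> ?r" for x y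
    using Q3D(2)[OF Q, of x y] by (auto simp: arrow_rel_def)
  have False if no_tri: "\<nexists>i j k. triangle Q i j k"
  proof -
    have short: "x \<noteq> y \<and> ((x, y) \<in> ?r \<or> (\<exists>z. (x, z) \<in> ?r \<and> (z, y) \<in> ?r))"
      if "(x, y) \<in> ?r\<^sup>+" for x y
      using that
    proof (induction rule: trancl_induct)
      case (base y)
      then show ?case using no_loop by auto
    next
      case (step y w)
      show ?case
      proof (cases "(x, y) \<in> ?r")
        case True
        then show ?thesis using step.hyps no_back by auto
      next
        case False
        then obtain z where z: "(x, z) \<in> ?r" "(z, y) \<in> ?r" and "x \<noteq> y"
          using step.IH by auto
        then have d: "distinct [x, z, y]" using no_loop by auto
        have "\<not> triangle Q x z y" using no_tri by blast
        then have "w \<noteq> x"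
          using z step.hyps(2) d Q by (auto simp: triangle_def arrow_rel_def)
        moreover have "w \<noteq> z" "w \<noteq> y"
          using z step.hyps(2) no_back no_loop by auto
        ultimately show ?thesis using three_cases[OF d, of w] by auto
      qed
    qed
    show False
      using assms(2) short by (auto simp: cyclic_quiver_def acyclic_quiver_def acyclic_def)
  qed
  then show thesis using that by blast
qed

lemma mutate_triangle:
  assumes "triangle Q i j k"
  shows "mutate k Q j i = Q j k * Q k i - Q i j" "mutate k Q i j = Q i j - Q j k * Q k i"
    "mutate k Q i k = Q k i" "mutate k Q k i = 0"
    "mutate k Q k j = Q j k" "mutate k Q j k = 0"
  using assms triangle_reverse_zero[OF assms]
  by (auto simp: triangle_def mutate_at mutate_away)

lemma mutate_triangle_acyclic:
  assumes T: "triangle Q i j k" and le: "Q j k * Q k i \<le> Q i j"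
  shows "acyclic_quiver (mutate k Q)"
proof (rule ccontr)
  assume "\<not> acyclic_quiver (mutate k Q)"
  then obtain u v w where "triangle (mutate k Q) u v w"
    using cyclic_imp_triangle[OF mutate_in_Q3] unfolding cyclic_quiver_def by metis
  moreover have d: "distinct [i, j, k]" using T by (auto simp: triangle_def)
  ultimately show False
    \<comment> \<open>every point of an oriented triangle is the source of an arrow, but \<open>j\<close> is a sink\<close>
    using three_cases[OF d, of u] three_cases[OF d, of v] three_cases[OF d, of w]
      mutate_triangle[OF T] le
    by (auto simp: triangle_def)
qed

lemma num_arrows_mutate_triangle:
  assumes T: "triangle Q i j k" and "Q i j \<le> Q j k * Q k i"
  shows "num_arrows (mutate k Q) < num_arrows Q \<longleftrightarrow> Q j k * Q k i < 2 * Q i j"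
proof -
  have d: "distinct [i, j, k]" "Q \<in> Q3" using T by (auto simp: triangle_def)
  show ?thesis
    using assms(2) num_arrows_three[OF d(2,1)] num_arrows_three[OF mutate_in_Q3 d(1), of k Q]
      mutate_triangle[OF T] triangle_reverse_zero[OF T]
    by linarith
qed

section \<open>Parameters and the opposite point\<close>

lemma three_distinct: "distinct [1, 2, 3 :: 3]"
  by simp

lemma isomorphic_to_cyclic_triangle:
  fixes Q :: "3 quiver"
  assumes "isomorphic_quivers Q (cyclic_triangle a b c)"
  obtains u v w where "distinct [u, v, w]" "Q v w = a" "Q w u = b" "Q u v = c"
proof -
  obtain f where f: "bij f" and Q: "\<And>i j. cyclic_triangle a b c (f i) (f j) = Q i j"
    using assms by (auto simp: isomorphic_quivers_def)
  obtain u v w where uvw: "f u = 3" "f v = 2" "f w = 1"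
    using bij_is_surj[OF f] by (metis surj_def)
  then have "distinct [u, v, w]" using three_distinct by auto
  moreover have "Q v w = a" "Q w u = b" "Q u v = c"
    unfolding Q[symmetric] uvw using three_distinct by (auto simp: cyclic_triangle_def)
  ultimately show thesis by (rule that)
qed

lemma isomorphic_to_cyclic_triangleI:
  fixes Q :: "3 quiver"
  assumes d: "distinct [u, v, w]"
    and Q: "\<And>i. Q i i = 0" "Q v u = 0" "Q w v = 0" "Q u w = 0"
  shows "isomorphic_quivers Q (cyclic_triangle (Q v w) (Q w u) (Q u v))"
proof -
  define f :: "3 \<Rightarrow> 3" where "f = (\<lambda>x. if x = u then 3 else if x = v then 2 else 1)"
  have f: "f u = 3" "f v = 2" "f w = 1" using d by (auto simp: f_def)
  have "x = y" if "f x = f y" for x y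
    using that three_cases[OF d, of x] three_cases[OF d, of y] three_distinct f
    by (elim disjE) auto
  then have "inj f" by (rule injI)
  then have "bij f" by (simp add: bij_def finite_UNIV_inj_surj)
  moreover have "cyclic_triangle (Q v w) (Q w u) (Q u v) (f i) (f j) = Q i j" for i j
    using three_cases[OF d, of i] three_cases[OF d, of j] three_distinct
    by (elim disjE) (simp_all add: f cyclic_triangle_def Q)
  ultimately show ?thesis by (auto simp: isomorphic_quivers_def)
qed

text \<open>Passing to the opposite quiver interchanges \<open>a\<close> and \<open>b\<close> along the cycle.\<close>
lemma has_parameters_triangle:
  assumes "Q \<in> Q3" and P: "has_parameters Q a b c"
  obtains u v w where "triangle Q u v w" "Q u v = c"
    "Q v w = a \<and> Q w u = b \<or> Q v w = b \<and> Q w u = a"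
proof -
  have pos: "0 < a" "0 < b" "0 < c" using P by (auto simp: has_parameters_def)
  consider "isomorphic_quivers Q (cyclic_triangle a b c)"
    | "isomorphic_quivers (opposite_quiver Q) (cyclic_triangle a b c)"
    using P by (auto simp: has_parameters_def iso_or_opposite_def)
  then show thesis
  proof cases
    case 1
    then obtain u v w where "distinct [u, v, w]" "Q v w = a" "Q w u = b" "Q u v = c"
      by (rule isomorphic_to_cyclic_triangle)
    then show thesis using that[of u v w] pos assms(1) by (simp add: triangle_def)
  next
    case 2
    then obtain u v w where "distinct [u, v, w]" "opposite_quiver Q v w = a"
      "opposite_quiver Q w u = b" "opposite_quiver Q u v = c"
      by (rule isomorphic_to_cyclic_triangle)
    then show thesis
      using that[of v u w] pos assms(1) by (auto simp: triangle_def opposite_quiver_def)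
  qed
qed

text \<open>
  If several sides have multiplicity \<open>c\<close>, the side opposite to \<open>k\<close> may be any of them;
  comparing the products of all three sides shows that the other two always multiply to
  \<open>a b\<close>.
\<close>
lemma opposite_point_triangle:
  assumes Q: "Q \<in> Q3" and P: "has_parameters Q a b c" and O: "opposite_point Q c k"
  obtains i j where "triangle Q i j k" "Q i j = c" "Q j k * Q k i = a * b"
proof -
  obtain u v w where T: "triangle Q u v w" and c: "Q u v = c"
    and ab: "Q v w = a \<and> Q w u = b \<or> Q v w = b \<and> Q w u = a"
    using has_parameters_triangle[OF Q P] .
  obtain i j where ij: "i \<noteq> j" "i \<noteq> k" "j \<noteq> k" "Q i j = c"
    using O by (auto simp: opposite_point_def)
  have cpos: "0 < c" using T c by (simp add: triangle_def)
  have d: "distinct [u, v, w]" using T by (simp add: triangle_def)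
  have "0 < Q i j" using ij cpos by simp
  then have "i = u \<and> j = v \<and> k = w \<or> i = v \<and> j = w \<and> k = u \<or> i = w \<and> j = u \<and> k = v"
    using three_cases[OF d, of i] three_cases[OF d, of j] three_cases[OF d, of k]
      ij(1-3) triangle_reverse_zero[OF T]
    by (elim disjE) auto
  then have Tijk: "triangle Q i j k \<and> Q i j * (Q j k * Q k i) = Q u v * (Q v w * Q w u)"
    using T triangle_rotate[OF T] triangle_rotate[OF triangle_rotate[OF T]]
    by (auto simp: mult_ac)
  have "Q j k * Q k i = a * b"
    using Tijk ab ij c cpos by (auto simp: mult.commute)
  then show thesis using that Tijk ij by blast
qed

lemma triangle_has_parameters:
  assumes "triangle Q i j k"
  obtains a b c m where "has_parameters Q a b c" "opposite_point Q c m"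
proof -
  obtain u v w where T: "triangle Q u v w" and le: "Q v w \<le> Q u v" "Q w u \<le> Q u v"
  proof -
    consider "Q j k \<le> Q i j \<and> Q k i \<le> Q i j" | "Q k i \<le> Q j k \<and> Q i j \<le> Q j k"
      | "Q i j \<le> Q k i \<and> Q j k \<le> Q k i"
      by linarith
    then show thesis
      using that assms triangle_rotate[OF assms] triangle_rotate[OF triangle_rotate[OF assms]]
      by cases blast+
  qed
  have d: "distinct [u, v, w]" and Q: "Q \<in> Q3"
    and pos: "0 < Q u v" "0 < Q v w" "0 < Q w u"
    using T by (auto simp: triangle_def)
  have O: "opposite_point Q (Q u v) w"
    using d by (auto simp: opposite_point_def)
  show thesis
  proof (cases "Q v w \<le> Q w u")
    case True
    have "isomorphic_quivers Q (cyclic_triangle (Q v w) (Q w u) (Q u v))"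
      using d triangle_reverse_zero[OF T] Q3D(1)[OF Q] by (intro isomorphic_to_cyclic_triangleI)
    then have "has_parameters Q (Q v w) (Q w u) (Q u v)"
      using True pos le by (simp add: has_parameters_def iso_or_opposite_def)
    then show thesis using that O by blast
  next
    case False
    have "isomorphic_quivers (opposite_quiver Q)
        (cyclic_triangle (opposite_quiver Q u w) (opposite_quiver Q w v) (opposite_quiver Q v u))"
      using d triangle_reverse_zero[OF T] Q3D(1)[OF Q]
      by (intro isomorphic_to_cyclic_triangleI) (auto simp: opposite_quiver_def)
    then have "has_parameters Q (Q w u) (Q v w) (Q u v)"
      using False pos le by (simp add: has_parameters_def iso_or_opposite_def opposite_quiver_def)
    then show thesis using that O by blast
  qed
qed

section \<open>Mutation classes\<close>

lemma isomorphic_acyclic: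
  assumes "isomorphic_quivers Q R" "acyclic_quiver R"
  shows "acyclic_quiver Q"
proof -
  obtain f where f: "\<And>i j. R (f i) (f j) = Q i j"
    using assms(1) by (auto simp: isomorphic_quivers_def)
  have "(f i, f j) \<in> (arrow_rel R)\<^sup>+" if "(i, j) \<in> (arrow_rel Q)\<^sup>+" for i j
    using that
  proof (induction rule: trancl_induct)
    case (base y)
    then show ?case by (auto simp: arrow_rel_def f)
  next
    case (step y z)
    have "(f y, f z) \<in> arrow_rel R" using step.hyps(2) by (simp add: arrow_rel_def f)
    with step.IH show ?case by (rule trancl_into_trancl)
  qed
  then show ?thesis
    using assms(2) by (auto simp: acyclic_quiver_def acyclic_def)
qed

lemma acyclic_opposite: "acyclic_quiver (opposite_quiver Q) \<longleftrightarrow> acyclic_quiver Q"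
proof -
  have "arrow_rel (opposite_quiver Q) = (arrow_rel Q)\<inverse>"
    by (auto simp: arrow_rel_def opposite_quiver_def)
  then show ?thesis by (simp add: acyclic_quiver_def)
qed

lemma mutation_acyclic_iff:
  "mutation_acyclic Q \<longleftrightarrow> (\<exists>ks. acyclic_quiver (fold mutate ks Q))"
proof
  assume "mutation_acyclic Q"
  then show "\<exists>ks. acyclic_quiver (fold mutate ks Q)"
    using isomorphic_acyclic acyclic_opposite
    by (fastforce simp: mutation_acyclic_def mutation_class_def iso_or_opposite_def)
next
  have "iso_or_opposite R R" for R :: "'a quiver"
    unfolding iso_or_opposite_def isomorphic_quivers_def using bij_id by fastforce
  then show "\<exists>ks. acyclic_quiver (fold mutate ks Q) \<Longrightarrow> mutation_acyclic Q"
    by (auto simp: mutation_acyclic_def mutation_class_def)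
qed

lemma fold_mutate_in_Q3: "Q \<in> Q3 \<Longrightarrow> fold mutate ks Q \<in> Q3"
  by (induction ks arbitrary: Q) (auto simp: mutate_in_Q3)

lemma fold_mutate_inverse: "Q \<in> Q3 \<Longrightarrow> fold mutate (rev ks) (fold mutate ks Q) = Q"
  by (induction ks arbitrary: Q) (auto simp: mutate_in_Q3 mutate_involution)

definition markov_quiver :: "3 quiver \<Rightarrow> bool" where
  "markov_quiver Q \<longleftrightarrow>
     (\<exists>i j k. triangle Q i j k \<and> markov_region (int (Q i j)) (int (Q j k)) (int (Q k i)))"

lemma markov_quiver_mutate:
  assumes "markov_quiver Q"
  shows "markov_quiver (mutate m Q)"
proof -
  \<comment> \<open>rotate the triangle so that its last point is the mutated one\<close>
  obtain i j where T: "triangle Q i j m"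
    and M: "markov_region (int (Q i j)) (int (Q j m)) (int (Q m i))"
  proof -
    obtain i j k where T: "triangle Q i j k"
      and M: "markov_region (int (Q i j)) (int (Q j k)) (int (Q k i))"
      using assms by (auto simp: markov_quiver_def)
    have "m = i \<or> m = j \<or> m = k"
      using T three_cases by (simp add: triangle_def)
    then show thesis
      using that T M triangle_rotate markov_region_rotate by blast
  qed
  have M': "markov_region (int (Q j m) * int (Q m i) - int (Q i j)) (int (Q m i)) (int (Q j m))"
    using M by (rule markov_region_step)
  then have "2 \<le> int (Q j m) * int (Q m i) - int (Q i j)"
    by (simp add: markov_region_def)
  then have "int (Q i j) \<le> int (Q j m * Q m i)" by simp
  then have "Q i j \<le> Q j m * Q m i" by (simp only: of_nat_le_iff)
  then have new: "int (mutate m Q j i) = int (Q j m) * int (Q m i) - int (Q i j)"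
    by (simp add: mutate_triangle[OF T] of_nat_diff)
  have "markov_region (int (mutate m Q j i)) (int (mutate m Q i m)) (int (mutate m Q m j))"
    unfolding new mutate_triangle(3,5)[OF T] by (rule M')
  moreover from this have "triangle (mutate m Q) j i m"
    using T by (auto simp: triangle_def markov_region_def mutate_in_Q3)
  ultimately show ?thesis unfolding markov_quiver_def by blast
qed

lemma markov_quiver_fold: "markov_quiver Q \<Longrightarrow> markov_quiver (fold mutate ks Q)"
  by (induction ks arbitrary: Q) (auto simp: markov_quiver_mutate)

text \<open>Going back along the involutions carries the region from \<open>fold mutate ks Q\<close> to \<open>Q\<close>.\<close>
lemma markov_quiver_mutation_cyclic:
  assumes "Q \<in> Q3" "markov_quiver (fold mutate ks Q)"
  shows "mutation_cyclic Q"
proof -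
  have "markov_quiver Q"
    using markov_quiver_fold[OF assms(2), of "rev ks"] fold_mutate_inverse[OF assms(1)] by simp
  then have "cyclic_quiver (fold mutate ls Q)" for ls
    using markov_quiver_fold[of Q ls] triangle_imp_cyclic by (auto simp: markov_quiver_def)
  then show ?thesis
    by (simp add: mutation_cyclic_def mutation_acyclic_iff cyclic_quiver_def)
qed

lemma root_markov_quiver:
  assumes "root Q"
  shows "markov_quiver Q"
proof -
  obtain a b c where Q: "Q \<in> Q3" and P: "has_parameters Q a b c"
    and "2 \<le> a" and "2 * c \<le> a * b"
    using assms by (auto simp: root_def)
  then have "2 \<le> int a" "int a \<le> int b" "int b \<le> int c" "2 * int c \<le> int a * int b"
    by (auto simp: has_parameters_def simp flip: of_nat_mult)
  then have M: "markov_region (int a) (int b) (int c)"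
    by (rule root_in_markov_region)
  then have "markov_region (int c) (int a) (int b)" "markov_region (int c) (int b) (int a)"
    by (auto simp: markov_region_def algebra_simps)
  then show ?thesis
    using has_parameters_triangle[OF Q P] unfolding markov_quiver_def by metis
qed

section \<open>The algorithm\<close>

lemma step_Halted: "\<not> step (Halted v R) t"
  by (auto elim: step.cases)

lemma step_exists:
  assumes "R \<in> Q3"
  shows "\<exists>t. step (Running R) t"
proof (cases "acyclic_quiver R")
  case True
  then show ?thesis by (blast intro: step.stop_acyclic)
next
  case False
  then have cyc: "cyclic_quiver R" by (simp add: cyclic_quiver_def)
  obtain i j k where "triangle R i j k" using cyclic_imp_triangle[OF assms cyc] .
  then obtain a b c m where "has_parameters R a b c" "opposite_point R c m"
    by (rule triangle_has_parameters)
  with cyc show ?thesis by (meson step.intros)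
qed

lemma no_infinite_run:
  "run 0 = Running Q \<Longrightarrow> \<not> (\<forall>n::nat. step (run n) (run (Suc n)))"
proof (induction "num_arrows Q" arbitrary: run Q rule: less_induct)
  case less
  show ?case
  proof
    assume *: "\<forall>n. step (run n) (run (Suc n))"
    have "step (Running Q) (run 1)" using *[rule_format, of 0] less.prems by simp
    then show False
    proof cases
      case (continue a b c k)
      then have "\<not> (\<forall>n. step ((\<lambda>n. run (Suc n)) n) ((\<lambda>n. run (Suc n)) (Suc n)))"
        by (intro less.hyps) auto
      then show False using * by auto
    qed (use * step_Halted in \<open>metis One_nat_def\<close>)+
  qed
qed

lemma reachable_state:
  assumes "step\<^sup>*\<^sup>* (Running Q) s"
  shows "\<exists>ks. s = Running (fold mutate ks Q) \<or>
    (\<exists>v. s = Halted v (fold mutate ks Q) \<and> step (Running (fold mutate ks Q)) s)"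
  using assms
proof (induction rule: rtranclp_induct)
  case base
  show ?case by (rule exI[of _ "[]"]) simp
next
  case (step s t)
  then obtain ks where s: "s = Running (fold mutate ks Q)"
    using step_Halted by blast
  from \<open>step s t\<close>[unfolded s] show ?case
  proof cases
    case (continue a b c k)
    then have "t = Running (fold mutate (ks @ [k]) Q)" by simp
    then show ?thesis by blast
  qed (use step.hyps(2) s in blast)+
qed

lemma stop_acyclic_sound:
  assumes R: "R \<in> Q3" and "step (Running R) (Halted Says_mutation_acyclic R)"
  shows "mutation_acyclic R"
  using assms(2)
proof cases
  case stop_acyclic
  then show ?thesis
    unfolding mutation_acyclic_iff by (intro exI[of _ "[]"]) simp
next
  case (stop_small_product a b c)
  then obtain u v w where "triangle R u v w" "R u v = c" "R v w * R w u = a * b"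
    using has_parameters_triangle[OF R] by (metis mult.commute)
  then have "acyclic_quiver (fold mutate [w] R)"
    using stop_small_product by (simp add: mutate_triangle_acyclic)
  then show ?thesis unfolding mutation_acyclic_iff by blast
qed

text \<open>
  The bound \<open>a \<ge> 2\<close> comes for free: \<open>a = 1\<close> would give \<open>b \<ge> 2 c \<ge> 2 b\<close>.
\<close>
lemma stop_cyclic_root:
  assumes R: "R \<in> Q3" and "step (Running R) (Halted Says_mutation_cyclic R)"
  shows "root R"
  using assms(2)
proof cases
  case (stop_root a b c k)
  obtain i j where "triangle R i j k" "R i j = c" "R j k * R k i = a * b"
    using opposite_point_triangle[OF R stop_root(2,4)] .
  then have le: "2 * c \<le> a * b"
    using num_arrows_mutate_triangle[of R i j k] stop_root(3,5) by simp
  have "0 < a" "a \<le> b" "b \<le> c" using stop_root(2) by (auto simp: has_parameters_def)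
  then have "a \<noteq> 1" using le by auto
  then have "2 \<le> a" using \<open>0 < a\<close> by simp
  then show ?thesis using R stop_root(1,2) le by (auto simp: root_def)
qed

theorem mainTheorem3:
  fixes Q :: "3 quiver"
  assumes "Q \<in> Q3" and "connected_quiver Q"
  shows "(\<nexists>run. run 0 = Running Q \<and> (\<forall>n::nat. step (run n) (run (Suc n))))
    \<and> (\<forall>s. step\<^sup>*\<^sup>* (Running Q) s \<and> (\<nexists>t. step s t) \<longrightarrow> (\<exists>v R. s = Halted v R))
    \<and> (\<forall>R. step\<^sup>*\<^sup>* (Running Q) (Halted Says_mutation_acyclic R) \<longrightarrow> mutation_acyclic Q)
    \<and> (\<forall>R. step\<^sup>*\<^sup>* (Running Q) (Halted Says_mutation_cyclic R) \<longrightarrow>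
          root R \<and> mutation_cyclic Q)"
proof (intro conjI allI impI)
  show "\<nexists>run. run 0 = Running Q \<and> (\<forall>n::nat. step (run n) (run (Suc n)))"
    using no_infinite_run by blast
next
  fix s assume s: "step\<^sup>*\<^sup>* (Running Q) s \<and> (\<nexists>t. step s t)"
  then show "\<exists>v R. s = Halted v R"
    using reachable_state step_exists fold_mutate_in_Q3[OF assms(1)] by blast
next
  fix R assume "step\<^sup>*\<^sup>* (Running Q) (Halted Says_mutation_acyclic R)"
  then obtain ks where R: "R = fold mutate ks Q"
    and st: "step (Running R) (Halted Says_mutation_acyclic R)"
    using reachable_state by blast
  have "mutation_acyclic R"
    using stop_acyclic_sound[OF _ st] fold_mutate_in_Q3[OF assms(1)] R by simp
  then obtain ls where "acyclic_quiver (fold mutate (ks @ ls) Q)"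
    by (auto simp: mutation_acyclic_iff R)
  then show "mutation_acyclic Q" unfolding mutation_acyclic_iff by blast
next
  fix R assume "step\<^sup>*\<^sup>* (Running Q) (Halted Says_mutation_cyclic R)"
  then obtain ks where R: "R = fold mutate ks Q"
    and st: "step (Running R) (Halted Says_mutation_cyclic R)"
    using reachable_state by blast
  show root: "root R"
    using stop_cyclic_root[OF _ st] fold_mutate_in_Q3[OF assms(1)] R by simp
  show "mutation_cyclic Q"
    using markov_quiver_mutation_cyclic[OF assms(1)] root_markov_quiver[OF root] R by blast
qed

end
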